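(* Let $p\in\mathbb{N}$, and let $\{d_n\}_{n=1}^{\infty}$ be a sequence of positive numbers generated by a function $d$, i.e. $d_n=d(n)$ for integers $n>p$, where $d$ is a real function defined and continuously differentiable on the interval $(p,\infty)$. Suppose that: (1) $\dfrac{d_{n+1}}{d_n}=1+O(d_n)$; (2) for some integer $m>p$, $d'(n)\neq 0$ for all integers $n\ge m+1$ and $$\sup_{n\ge m+1,\ \zeta,\eta\in[-1,2]}\frac{|d'(n+\zeta)|}{|d'(n+\eta)|}<\infty;$$ (3) there exists $k\in\mathbb{N}$ such that $\left|\dfrac{d'(n)}{d_n}\right|^{k}=O(d_n^2)$. Let $r_0=1$, $r_n=\sqrt{d_n+d_{n+1}}$ for $n\ge 1$, and $$F(n)=\frac{1}{d_{n}}\Bigl(\frac{r_n}{r_{n-1}}-1\Bigr)+\frac{1}{d_{n+1}}\Bigl(\frac{r_n}{r_{n+1}}-1\Bigr)\qquad(n\in\mathbb{N}).$$ Then there exist numbers $C_0,C_1,\dots,C_{k-1}$ such that, for $k$ from (3), $$F(n)=\frac{1}{d_n}\sum_{i=1}^{k-1}C_{i}\,u(n)^i+\frac{1}{d_{n+1}}\sum_{i=1}^{k-1}C_{i}\,v(n)^i+O(d_n),$$ where $$u(n)=\frac{d_{n+1}-d_{n-1}}{d_{n}+d_{n-1}},\qquad v(n)=\frac{d_{n}-d_{n+2}}{d_{n+1}+d_{n+2}}.$$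
   Context: $\mathbb{N}=\{1,2,\dots\}$. For a positive sequence $(b_n)$, the notation $a_n=O(b_n)$ means that there is a constant $K>0$ with $|a_n|\le K b_n$ for all sufficiently large $n$, and $a_n=c_n+O(b_n)$ means $a_n-c_n=O(b_n)$. In the supremum $n$ ranges over integers and $\zeta,\eta$ over reals in $[-1,2]$; finiteness of the supremum is understood to include that all the denominators are nonzero. Empty sums are zero. *)

theory Defs
  imports "HOL-Analysis.Analysis" "HOL-Library.Landau_Symbols"
begin

text \<open>The sequence \<open>d\<close> is indexed by \<open>n \<ge> 1\<close>; its value at \<open>0\<close> is an
  irrelevant dummy. It is used only in \<open>u_seq d 1\<close> (and in the junk values at index \<open>0\<close>).\<close>

definition r_seq :: "(nat \<Rightarrow> real) \<Rightarrow> nat \<Rightarrow> real" where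
  "r_seq d n = (if n = 0 then 1 else sqrt (d n + d (n + 1)))"

definition F_seq :: "(nat \<Rightarrow> real) \<Rightarrow> nat \<Rightarrow> real" where
  "F_seq d n = 1 / d n * (r_seq d n / r_seq d (n - 1) - 1)
             + 1 / d (n + 1) * (r_seq d n / r_seq d (n + 1) - 1)"

definition u_seq :: "(nat \<Rightarrow> real) \<Rightarrow> nat \<Rightarrow> real" where
  "u_seq d n = (d (n + 1) - d (n - 1)) / (d n + d (n - 1))"

definition v_seq :: "(nat \<Rightarrow> real) \<Rightarrow> nat \<Rightarrow> real" where
  "v_seq d n = (d n - d (n + 2)) / (d (n + 1) + d (n + 2))"

end

theory Submission
  imports Defs
begin

text \<open>Up to the prefactors \<open>1 / d n\<close> and \<open>1 / d (n + 1)\<close>, both summands of \<open>F\<close> are values of the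
  single function \<open>w \<mapsto> sqrt (1 + w) - 1\<close>:
  \<open>r n / r (n - 1) = sqrt (1 + u n)\<close> and \<open>r n / r (n + 1) = sqrt (1 + v n)\<close> for \<open>n \<ge> 2\<close>
  (for \<open>n = 1\<close> the convention \<open>r 0 = 1\<close> interferes). So the
  numbers \<open>C i\<close> are the binomial coefficients \<open>1/2 gchoose i\<close>, and what has to be estimated is the
  Taylor remainder of order \<open>k\<close> at \<open>u n\<close> and \<open>v n\<close>.

  This remainder is bounded by \<open>K * \<bar>w\<bar> ^ k\<close> for every \<open>w \<ge> -1\<close>, not only near \<open>0\<close>
  (\<open>sqrt_taylor_remainder\<close>), so that \<open>u\<close> and \<open>v\<close> do not have to be small. By the mean value
  theorem and the comparability of the values of \<open>d'\<close> on \<open>[n - 1, n + 2]\<close>, the numerators of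
  \<open>u n\<close> and \<open>v n\<close> are at most a constant times \<open>\<bar>d' j\<bar>\<close>, for \<open>j = n\<close> as well as for
  \<open>j = n + 1\<close> (\<open>increment_le_deriv\<close>). The growth condition \<open>\<bar>d' j / d j\<bar> ^ k = O(d j ^ 2)\<close>
  then turns \<open>\<bar>w\<bar> ^ k\<close> into a multiple of \<open>d j ^ 2\<close>, of which one factor is spent on the
  prefactor (\<open>scaled_remainder_le\<close>).

  In the term with \<open>u\<close> the index is \<open>j = n\<close>. In the term with \<open>v\<close>, whose prefactor is
  \<open>1 / d (n + 1)\<close>, the index \<open>j\<close> is the one of \<open>n\<close>, \<open>n + 1\<close> at which \<open>d\<close> is smaller: then
  \<open>d j\<close> is a lower bound of the denominators and the resulting bound \<open>O(d j)\<close> is \<open>O(d n)\<close>.\<close>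

text \<open>For \<open>\<bar>w\<bar> \<le> 1/2\<close> the factor \<open>w ^ k\<close> can be taken out of the tail of the binomial
  series. For \<open>\<bar>w\<bar> > 1/2\<close> the function itself and every monomial of degree at most \<open>k\<close> are
  dominated by a multiple of \<open>\<bar>w\<bar> ^ k\<close>.\<close>

lemma sqrt_taylor_remainder:
  fixes k :: nat
  assumes "k \<ge> 1"
  shows "\<exists>K\<ge>0. \<forall>w\<ge>-1.
    \<bar>sqrt (1 + w) - 1 - (\<Sum>i=1..k-1. ((1/2::real) gchoose i) * w ^ i)\<bar> \<le> K * \<bar>w\<bar> ^ k"
proof -
  define c :: "nat \<Rightarrow> real" where "c i = (1/2) gchoose i" for i
  have "summable (\<lambda>i. c i * (3/4) ^ i)"
    using gen_binomial_real[of "3/4" "1/2"] by (auto simp: c_def sums_iff)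
  then have summ: "summable (\<lambda>i. norm (c i * (1/2) ^ i))"
    by (rule powser_insidea) auto
  define S where "S = (\<Sum>i. \<bar>c i\<bar> * (1/2) ^ i)"
  have summ': "summable (\<lambda>i. \<bar>c i\<bar> * (1/2) ^ i)"
    using summ by (simp add: abs_mult)
  have S_nonneg: "S \<ge> 0"
    unfolding S_def by (rule suminf_nonneg[OF summ']) auto
  define T where "T = (\<Sum>i=1..k-1. \<bar>c i\<bar>)"
  have T_nonneg: "T \<ge> 0" unfolding T_def by (intro sum_nonneg) auto
  have low: "\<bar>sqrt (1 + w) - 1 - (\<Sum>i=1..k-1. c i * w ^ i)\<bar> \<le> 2 ^ k * S * \<bar>w\<bar> ^ k"
    if w: "\<bar>w\<bar> \<le> 1/2" for w
  proof -
    have "(\<lambda>i. c i * w ^ i) sums ((1 + w) powr (1/2))"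
      unfolding c_def by (rule gen_binomial_real) (use w in auto)
    then have sums: "(\<lambda>i. c i * w ^ i) sums sqrt (1 + w)"
      using w by (simp add: powr_half_sqrt)
    have "{..<k} = insert 0 {1..k-1}" using assms by auto
    then have "(\<Sum>i<k. c i * w ^ i) = 1 + (\<Sum>i=1..k-1. c i * w ^ i)"
      by (simp add: c_def)
    then have tail: "(\<lambda>i. c (i + k) * w ^ (i + k)) sums
        (sqrt (1 + w) - 1 - (\<Sum>i=1..k-1. c i * w ^ i))"
      using sums_split_initial_segment[OF sums, of k] by (simp add: algebra_simps)
    have tail_S: "(\<lambda>i. \<bar>c (i + k)\<bar> * (1/2) ^ (i + k)) sums
        (S - (\<Sum>i<k. \<bar>c i\<bar> * (1/2) ^ i))"
      unfolding S_def by (intro sums_split_initial_segment summable_sums summ')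
    have bound: "norm (c (i + k) * w ^ (i + k)) \<le>
        2 ^ k * \<bar>w\<bar> ^ k * (\<bar>c (i + k)\<bar> * (1/2) ^ (i + k))" for i
    proof -
      have "\<bar>w\<bar> ^ i \<le> (1/2) ^ i" using w by (intro power_mono) auto
      then have "\<bar>c (i + k)\<bar> * \<bar>w\<bar> ^ k * \<bar>w\<bar> ^ i \<le> \<bar>c (i + k)\<bar> * \<bar>w\<bar> ^ k * (1/2) ^ i"
        by (intro mult_left_mono) auto
      then show ?thesis
        by (simp add: abs_mult power_abs power_add power_divide field_simps)
    qed
    have "norm (\<Sum>i. c (i + k) * w ^ (i + k)) \<le>
        (\<Sum>i. 2 ^ k * \<bar>w\<bar> ^ k * (\<bar>c (i + k)\<bar> * (1/2) ^ (i + k)))"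
      by (rule norm_suminf_le[OF bound]) (intro summable_mult sums_summable[OF tail_S])
    also have "\<dots> = 2 ^ k * \<bar>w\<bar> ^ k * (S - (\<Sum>i<k. \<bar>c i\<bar> * (1/2) ^ i))"
      using tail_S by (simp add: suminf_mult sums_iff)
    also have "\<dots> \<le> 2 ^ k * \<bar>w\<bar> ^ k * S"
      by (intro mult_left_mono) (auto intro!: sum_nonneg)
    finally show ?thesis
      using sums_unique[OF tail] by (simp add: mult_ac)
  qed
  have high: "\<bar>sqrt (1 + w) - 1 - (\<Sum>i=1..k-1. c i * w ^ i)\<bar> \<le> 2 ^ k * (1 + T) * \<bar>w\<bar> ^ k"
    if w: "\<bar>w\<bar> > 1/2" "w \<ge> -1" for w
  proof -
    have mono: "\<bar>w\<bar> ^ i \<le> 2 ^ k * \<bar>w\<bar> ^ k" if "i \<le> k" for i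
    proof -
      have "\<bar>w\<bar> ^ i \<le> 2 ^ i * \<bar>w\<bar> ^ i"
        using mult_right_mono[OF one_le_power[of "2::real" i], of "\<bar>w\<bar> ^ i"] by simp
      also have "\<dots> = (2 * \<bar>w\<bar>) ^ i" by (simp add: power_mult_distrib)
      also have "\<dots> \<le> (2 * \<bar>w\<bar>) ^ k" using w that by (intro power_increasing) auto
      finally show ?thesis by (simp add: power_mult_distrib)
    qed
    have "\<bar>sqrt (1 + w) - 1\<bar> * 1 \<le> \<bar>sqrt (1 + w) - 1\<bar> * \<bar>sqrt (1 + w) + 1\<bar>"
      using w by (intro mult_left_mono) auto
    also have "\<dots> = \<bar>w\<bar>"
      unfolding abs_mult[symmetric] using w by (simp add: algebra_simps)
    finally have sqrt_le: "\<bar>sqrt (1 + w) - 1\<bar> \<le> 2 ^ k * \<bar>w\<bar> ^ k"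
      using mono[of 1] assms by simp
    have "\<bar>\<Sum>i=1..k-1. c i * w ^ i\<bar> \<le> (\<Sum>i=1..k-1. \<bar>c i\<bar> * (2 ^ k * \<bar>w\<bar> ^ k))"
      by (rule order.trans[OF sum_abs], intro sum_mono)
        (auto simp: abs_mult power_abs intro!: mult_left_mono mono)
    also have "\<dots> = T * (2 ^ k * \<bar>w\<bar> ^ k)"
      by (simp add: T_def sum_distrib_right)
    finally show ?thesis using sqrt_le by (simp add: algebra_simps)
  qed
  define K where "K = 2 ^ k * S + 2 ^ k * (1 + T)"
  have K_nonneg: "K \<ge> 0" using S_nonneg T_nonneg by (simp add: K_def)
  have "2 ^ k * S * \<bar>w\<bar> ^ k \<le> K * \<bar>w\<bar> ^ k" "2 ^ k * (1 + T) * \<bar>w\<bar> ^ k \<le> K * \<bar>w\<bar> ^ k"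
    for w :: real
    using S_nonneg T_nonneg by (intro mult_right_mono; simp add: K_def)+
  then have "\<bar>sqrt (1 + w) - 1 - (\<Sum>i=1..k-1. c i * w ^ i)\<bar> \<le> K * \<bar>w\<bar> ^ k"
    if "w \<ge> -1" for w
    using low[of w] high[of w] that by (meson linorder_not_less order_trans)
  then show ?thesis using K_nonneg unfolding c_def by blast
qed

text \<open>The mean value theorem gives an increment of \<open>d\<close> as the derivative at an uncontrolled
  intermediate point; comparability of the derivatives on an interval allows this point to be
  replaced by any prescribed \<open>\<eta>\<close>.\<close>

lemma increment_le_deriv:
  fixes d :: "real \<Rightarrow> real"
  assumes "a < b"
    and diff: "\<And>x. a \<le> x \<Longrightarrow> x \<le> b \<Longrightarrow> d differentiable (at x)"
    and compare: "\<And>x. a \<le> x \<Longrightarrow> x \<le> b \<Longrightarrow> \<bar>deriv d x\<bar> \<le> M * \<bar>deriv d \<eta>\<bar>"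
  shows "\<bar>d b - d a\<bar> \<le> (b - a) * (M * \<bar>deriv d \<eta>\<bar>)"
proof -
  have "(d has_real_derivative deriv d x) (at x)" if "a \<le> x" "x \<le> b" for x
    using diff[OF that] by (simp add: DERIV_deriv_iff_real_differentiable)
  from MVT2[OF \<open>a < b\<close> this] obtain \<xi>
    where \<xi>: "a < \<xi>" "\<xi> < b" "d b - d a = (b - a) * deriv d \<xi>" by blast
  then show ?thesis
    using compare[of \<xi>] \<open>a < b\<close> by (simp add: abs_mult mult_left_mono)
qed

text \<open>Here \<open>\<rho>\<close> is the Taylor remainder, and \<open>x\<close>, \<open>\<delta>\<close> are the values at one index of the
  sequence and of the derivative. Since \<open>x\<close> is a lower bound of the denominator \<open>D\<close> and of \<open>e\<close>,
  the power \<open>\<bar>\<delta> / x\<bar> ^ k = O(x^2)\<close> controls the remainder, and dividing by \<open>e\<close> costs one factor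
  \<open>x\<close>.\<close>

lemma scaled_remainder_le:
  fixes \<rho> :: "real \<Rightarrow> real"
  assumes rem: "\<bar>\<rho> (\<Delta> / D)\<bar> \<le> K * \<bar>\<Delta> / D\<bar> ^ k"
    and "K \<ge> 0" "A \<ge> 0" "B \<ge> 0" "x > 0" "x \<le> D" "x \<le> e"
    and num: "\<bar>\<Delta>\<bar> \<le> A * \<bar>\<delta>\<bar>"
    and growth: "\<bar>\<delta> / x\<bar> ^ k \<le> B * x\<^sup>2"
  shows "\<bar>1 / e * \<rho> (\<Delta> / D)\<bar> \<le> K * A ^ k * B * x"
proof -
  have "\<bar>\<Delta> / D\<bar> = \<bar>\<Delta>\<bar> / D" using assms by simp
  also have "\<dots> \<le> A * \<bar>\<delta>\<bar> / x" using assms by (intro frac_le) auto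
  finally have "\<bar>\<Delta> / D\<bar> \<le> A * \<bar>\<delta> / x\<bar>" using \<open>x > 0\<close> by simp
  then have "\<bar>\<Delta> / D\<bar> ^ k \<le> (A * \<bar>\<delta> / x\<bar>) ^ k" by (intro power_mono) auto
  also have "\<dots> \<le> A ^ k * (B * x\<^sup>2)"
    unfolding power_mult_distrib using growth \<open>A \<ge> 0\<close> by (intro mult_left_mono) auto
  finally have "K * \<bar>\<Delta> / D\<bar> ^ k \<le> K * (A ^ k * (B * x\<^sup>2))"
    using \<open>K \<ge> 0\<close> by (rule mult_left_mono)
  with rem have rho: "\<bar>\<rho> (\<Delta> / D)\<bar> \<le> K * (A ^ k * (B * x\<^sup>2))" by linarith
  have "\<bar>1 / e * \<rho> (\<Delta> / D)\<bar> = \<bar>\<rho> (\<Delta> / D)\<bar> / e" using assms by (simp add: abs_mult)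
  also have "\<dots> \<le> K * (A ^ k * (B * x\<^sup>2)) / x" using assms rho by (intro frac_le) auto
  also have "\<dots> = K * A ^ k * B * x" using \<open>x > 0\<close> by (simp add: power2_eq_square)
  finally show ?thesis .
qed

lemma F_seq_eq_sqrt:
  assumes pos: "\<And>i. i \<ge> 1 \<Longrightarrow> d i > 0" and "n \<ge> 2"
  shows "F_seq d n = 1 / d n * (sqrt (1 + u_seq d n) - 1)
                   + 1 / d (n + 1) * (sqrt (1 + v_seq d n) - 1)"
proof -
  have p: "d (n - 1) > 0" "d n > 0" "d (n + 1) > 0" "d (n + 2) > 0"
    using \<open>n \<ge> 2\<close> by (auto intro: pos)
  have u: "1 + u_seq d n = (d n + d (n + 1)) / (d (n - 1) + d n)"
    using p by (simp add: u_seq_def field_simps)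
  have v: "1 + v_seq d n = (d n + d (n + 1)) / (d (n + 1) + d (n + 2))"
    using p by (simp add: v_seq_def field_simps)
  show ?thesis
    unfolding u v F_seq_def r_seq_def real_sqrt_divide using \<open>n \<ge> 2\<close> by simp
qed

theorem proposition6:
  fixes p k :: nat and ds :: "nat \<Rightarrow> real" and d :: "real \<Rightarrow> real"
  assumes p_pos: "p \<ge> 1"
    and ds_pos: "\<And>n. n \<ge> 1 \<Longrightarrow> ds n > 0"
    and ds_d: "\<And>n. n > p \<Longrightarrow> ds n = d (real n)"
    and d_C1: "d C1_differentiable_on {real p<..}"
    and ratio: "(\<lambda>n. ds (n + 1) / ds n - 1) \<in> O(ds)"
    and deriv_ratio: "\<exists>m>p. (\<forall>n\<ge>m+1. deriv d (real n) \<noteq> 0) \<and>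
          (\<forall>n\<ge>m+1. \<forall>\<eta>\<in>{-1..2}. deriv d (real n + \<eta>) \<noteq> 0) \<and>
          bdd_above {\<bar>deriv d (real n + \<zeta>)\<bar> / \<bar>deriv d (real n + \<eta>)\<bar> | n \<zeta> \<eta>.
            n \<ge> m + 1 \<and> \<zeta> \<in> {-1..2} \<and> \<eta> \<in> {-1..2}}"
    and k_pos: "k \<ge> 1"
    and deriv_k: "(\<lambda>n. \<bar>deriv d (real n) / ds n\<bar> ^ k) \<in> O(\<lambda>n. (ds n)\<^sup>2)"
  shows "\<exists>C :: nat \<Rightarrow> real.
           (\<lambda>n. F_seq ds n -
                 (1 / ds n * (\<Sum>i=1..k-1. C i * u_seq ds n ^ i)
                  + 1 / ds (n + 1) * (\<Sum>i=1..k-1. C i * v_seq ds n ^ i))) \<in> O(ds)"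
proof -
  define c :: "nat \<Rightarrow> real" where "c i = (1/2) gchoose i" for i
  define \<rho> where "\<rho> w = sqrt (1 + w) - 1 - (\<Sum>i=1..k-1. c i * w ^ i)" for w
  obtain K where K: "K \<ge> 0" "\<And>w. w \<ge> -1 \<Longrightarrow> \<bar>\<rho> w\<bar> \<le> K * \<bar>w\<bar> ^ k"
    using sqrt_taylor_remainder[OF k_pos] unfolding \<rho>_def c_def by blast
  obtain B where B: "B > 0"
    "\<forall>\<^sub>F n in sequentially. \<bar>deriv d (real n) / ds n\<bar> ^ k \<le> B * (ds n)\<^sup>2"
    using landau_o.bigE[OF deriv_k] by (auto simp: power_abs)
  obtain N where N: "\<And>n. n \<ge> N \<Longrightarrow> \<bar>deriv d (real n) / ds n\<bar> ^ k \<le> B * (ds n)\<^sup>2"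
    using B(2) by (auto simp: eventually_sequentially)
  obtain m M where "m > p"
    and nz': "\<forall>n\<ge>m+1. \<forall>\<eta>\<in>{-1..2}. deriv d (real n + \<eta>) \<noteq> 0"
    and M': "\<forall>q\<in>{\<bar>deriv d (real n + \<zeta>)\<bar> / \<bar>deriv d (real n + \<eta>)\<bar> | n \<zeta> \<eta>.
            n \<ge> m + 1 \<and> \<zeta> \<in> {-1..2} \<and> \<eta> \<in> {-1..2}}. q \<le> M"
    using deriv_ratio unfolding bdd_above_def by (elim exE conjE) rule
  have nz: "deriv d (real n + \<eta>) \<noteq> 0" if "n \<ge> m + 1" "\<eta> \<in> {-1..2}" for n \<eta>
    using nz' that by blast
  have M: "\<bar>deriv d (real n + \<zeta>)\<bar> / \<bar>deriv d (real n + \<eta>)\<bar> \<le> M"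
    if "n \<ge> m + 1" "\<zeta> \<in> {-1..2}" "\<eta> \<in> {-1..2}" for n \<zeta> \<eta>
    by (rule bspec[OF M']) (use that in blast)
  have "M \<ge> 0"
    by (rule order.trans[OF _ M[of "m + 1" 0 0]]) auto
  have diff: "d differentiable (at x)" if "x > real p" for x
    using d_C1 that
    by (auto simp: C1_differentiable_on_def real_differentiable_def
        has_real_derivative_iff_has_vector_derivative)
  have incr: "\<bar>d b - d a\<bar> \<le> (b - a) * (M * \<bar>deriv d (real n + \<eta>)\<bar>)"
    if n: "n \<ge> m + 1" and ab: "real n - 1 \<le> a" "a < b" "b \<le> real n + 2"
      and \<eta>: "\<eta> \<in> {-1..2}" for n a b \<eta>
  proof (rule increment_le_deriv[OF \<open>a < b\<close>])
    fix x assume x: "a \<le> x" "x \<le> b"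
    show "d differentiable (at x)"
      using x ab n \<open>m > p\<close> by (intro diff) linarith
    show "\<bar>deriv d x\<bar> \<le> M * \<bar>deriv d (real n + \<eta>)\<bar>"
      using M[OF n _ \<eta>, of "x - real n"] nz[OF n \<eta>] x ab by (simp add: divide_le_eq)
  qed

  have u_bound: "\<bar>1 / ds n * \<rho> (u_seq ds n)\<bar> \<le> K * (2 * M) ^ k * B * ds n"
    if n: "n \<ge> N + m + 2" for n
    unfolding u_seq_def
  proof (rule scaled_remainder_le)
    have pos: "ds (n - 1) > 0" "ds n > 0" "ds (n + 1) > 0"
      using n by (auto intro: ds_pos)
    show "\<bar>\<rho> ((ds (n + 1) - ds (n - 1)) / (ds n + ds (n - 1)))\<bar>
        \<le> K * \<bar>(ds (n + 1) - ds (n - 1)) / (ds n + ds (n - 1))\<bar> ^ k"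
      using pos by (intro K(2)) (simp add: le_divide_eq)
    have "ds (n + 1) = d (real n + 1)" "ds (n - 1) = d (real n - 1)"
      using n \<open>m > p\<close> by (simp_all add: ds_d of_nat_diff add.commute)
    then show "\<bar>ds (n + 1) - ds (n - 1)\<bar> \<le> 2 * M * \<bar>deriv d (real n)\<bar>"
      using incr[of n "real n - 1" "real n + 1" 0] n by simp
    show "\<bar>deriv d (real n) / ds n\<bar> ^ k \<le> B * (ds n)\<^sup>2" using n by (intro N) auto
  qed (use K(1) B(1) \<open>M \<ge> 0\<close> n in \<open>auto intro!: ds_pos less_imp_le[OF ds_pos]\<close>)

  have v_bound: "\<bar>1 / ds (n + 1) * \<rho> (v_seq ds n)\<bar> \<le> K * (2 * M) ^ k * B * ds n"
    if n: "n \<ge> N + m + 2" for n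
  proof -
    have pos: "ds n > 0" "ds (n + 1) > 0" "ds (n + 2) > 0"
      using n by (auto intro: ds_pos)
    \<comment> \<open>The smaller value serves in both directions: \<open>1 / ds j\<close> bounds the prefactor
      \<open>1 / ds (n + 1)\<close> from above, and a bound by a multiple of \<open>ds j\<close> is one by a multiple
      of \<open>ds n\<close>.\<close>
    define j where "j = (if ds n \<le> ds (n + 1) then n else n + 1)"
    have j: "j \<ge> N" "ds j > 0" "ds j \<le> ds n" "ds j \<le> ds (n + 1)"
      and j_eq: "real j - real n \<in> {-1..2}"
      using n pos by (auto simp: j_def)
    have "\<bar>1 / ds (n + 1) * \<rho> (v_seq ds n)\<bar> \<le> K * (2 * M) ^ k * B * ds j"
      unfolding v_seq_def
    proof (rule scaled_remainder_le)
      show "\<bar>\<rho> ((ds n - ds (n + 2)) / (ds (n + 1) + ds (n + 2)))\<bar>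
          \<le> K * \<bar>(ds n - ds (n + 2)) / (ds (n + 1) + ds (n + 2))\<bar> ^ k"
        using pos by (intro K(2)) (simp add: le_divide_eq)
      have "ds (n + 2) = d (real n + 2)" "ds n = d (real n)"
        using n \<open>m > p\<close> by (simp_all add: ds_d add.commute)
      then show "\<bar>ds n - ds (n + 2)\<bar> \<le> 2 * M * \<bar>deriv d (real j)\<bar>"
        using incr[of n "real n" "real n + 2" "real j - real n"] n j_eq
        by (simp add: abs_minus_commute)
      show "\<bar>deriv d (real j) / ds j\<bar> ^ k \<le> B * (ds j)\<^sup>2" using j by (intro N) auto
    qed (use K(1) B(1) \<open>M \<ge> 0\<close> j pos in auto)
    also have "\<dots> \<le> K * (2 * M) ^ k * B * ds n"
      using K(1) B(1) \<open>M \<ge> 0\<close> j by (intro mult_left_mono) auto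
    finally show ?thesis .
  qed

  have "(\<lambda>n. F_seq ds n -
          (1 / ds n * (\<Sum>i=1..k-1. c i * u_seq ds n ^ i)
           + 1 / ds (n + 1) * (\<Sum>i=1..k-1. c i * v_seq ds n ^ i))) \<in> O(ds)"
  proof (rule bigoI[where c = "2 * (K * (2 * M) ^ k * B)"], rule eventually_sequentiallyI)
    fix n assume n: "N + m + 2 \<le> n"
    have "F_seq ds n - (1 / ds n * (\<Sum>i=1..k-1. c i * u_seq ds n ^ i)
            + 1 / ds (n + 1) * (\<Sum>i=1..k-1. c i * v_seq ds n ^ i))
        = 1 / ds n * \<rho> (u_seq ds n) + 1 / ds (n + 1) * \<rho> (v_seq ds n)"
      using F_seq_eq_sqrt[of ds n, OF ds_pos] n by (simp add: \<rho>_def right_diff_distrib)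
    moreover have "norm (ds n) = ds n" using ds_pos[of n] n by simp
    ultimately show "norm (F_seq ds n - (1 / ds n * (\<Sum>i=1..k-1. c i * u_seq ds n ^ i)
            + 1 / ds (n + 1) * (\<Sum>i=1..k-1. c i * v_seq ds n ^ i)))
        \<le> 2 * (K * (2 * M) ^ k * B) * norm (ds n)"
      using u_bound[OF n] v_bound[OF n] unfolding real_norm_def by linarith
  qed
  then show ?thesis by blast
qed

end
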